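(* Let $2\le p<\infty$, $\beta\in\mathbb{R}$, and $\theta:=\operatorname{dist}(\beta,\mathbb{Z})$. Then for all complex-valued $u\in C_c^\infty(\mathbb{R}^2\setminus\{0\})$, $$\int_{\mathbb{R}^2}|\nabla_{A_\beta}u|^p\,dx\ \ge\ \left[\left(\frac{p-2}{p}\right)^p+\left(\frac{\sin(\pi\theta)}{\pi}\right)^p\right]\int_{\mathbb{R}^2}\frac{|u|^p}{|x|^p}\,dx .$$
   Context: The two-dimensional Aharonov--Bohm potential is $A_\beta(x)=\beta\,\dfrac{(x_2,-x_1)}{|x|^2}$ for $x=(x_1,x_2)\in\mathbb{R}^2\setminus\{0\}$. The magnetic gradient of a complex-valued function $u$ is $\nabla_{A_\beta}u:=\nabla u+iA_\beta u$, a $\mathbb{C}^2$-valued function on $\mathbb{R}^2\setminus\{0\}$, and $|\nabla_{A_\beta}u|$ is its Euclidean (Hermitian) norm in $\mathbb{C}^2$. $\operatorname{dist}(\beta,\mathbb{Z})=\min_{n\in\mathbb{Z}}|\beta-n|$. *)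

theory Defs
  imports "HOL-Analysis.Analysis"
begin

definition partial_deriv :: "2 \<Rightarrow> (real^2 \<Rightarrow> complex) \<Rightarrow> real^2 \<Rightarrow> complex" where
  "partial_deriv i u x = frechet_derivative u (at x) (axis i 1)"

(* Intended for open S only, where differentiability within S is differentiability at each point. *)
primrec Ck_on :: "nat \<Rightarrow> (real^2) set \<Rightarrow> (real^2 \<Rightarrow> complex) \<Rightarrow> bool" where
  "Ck_on 0 S u = continuous_on S u"
| "Ck_on (Suc k) S u = (u differentiable_on S \<and> (\<forall>i. Ck_on k S (partial_deriv i u)))"

definition Cinf_on :: "(real^2) set \<Rightarrow> (real^2 \<Rightarrow> complex) \<Rightarrow> bool" where
  "Cinf_on S u \<longleftrightarrow> (\<forall>k. Ck_on k S u)"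

definition supp :: "(real^2 \<Rightarrow> complex) \<Rightarrow> (real^2) set" where
  "supp u = closure {x. u x \<noteq> 0}"

(* Elements of C_c^infinity(S) are represented by their extension by zero to the whole plane;
   the closure in supp is taken in the plane, so supp u is a compact subset of the open set S. *)
definition Cc_inf :: "(real^2) set \<Rightarrow> (real^2 \<Rightarrow> complex) set" where
  "Cc_inf S = {u. Cinf_on S u \<and> compact (supp u) \<and> supp u \<subseteq> S}"

definition AB_potential :: "real \<Rightarrow> real^2 \<Rightarrow> real^2" where
  "AB_potential \<beta> x = (\<beta> / (norm x)\<^sup>2) *\<^sub>R vector [x $ 2, - x $ 1]"

(* The norm on complex^2 is the Hermitian norm. *)
definition magnetic_grad :: "(real^2 \<Rightarrow> real^2) \<Rightarrow> (real^2 \<Rightarrow> complex) \<Rightarrow> real^2 \<Rightarrow> complex^2" where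
  "magnetic_grad A u x = (\<chi> i. partial_deriv i u x + \<i> * of_real (A x $ i) * u x)"

end

theory Submission
  imports Defs
begin

text \<open>
  For \<open>x \<noteq> 0\<close>, the magnetic gradient splits orthogonally into the radial derivative of \<open>u\<close> and
  \<open>1 / |x|\<close> times the derivative of \<open>cis (- \<beta> t) * u (rot t x)\<close> at \<open>t = 0\<close>; since \<open>p \<ge> 2\<close>, the
  \<open>p\<close>-th power of its norm is at least the sum of the \<open>p\<close>-th powers of the two parts. Each part is
  bounded below without polar coordinates: the value \<open>u x\<close> is recovered as the increment of a
  function along a path through \<open>x\<close> (the dilations \<open>t powr k *\<^sub>R x\<close> with \<open>k = p / (p - 2)\<close>,
  respectively the rotations \<open>rot t x\<close>), Jensen's inequality bounds the \<open>p\<close>-th power of the increment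
  by the integral of the \<open>p\<close>-th power of the derivative, and integration over \<open>x\<close> with Tonelli's
  theorem and the behaviour of Lebesgue measure under the maps of the family removes the parameter \<open>t\<close>.
\<close>

section \<open>Inequalities for real powers\<close>

text \<open>A convex function lies above its tangent at \<open>c\<close>. The convexity argument
  runs in the open half-line, so \<open>c = 0\<close> and \<open>y = 0\<close> are settled
  separately.\<close>

lemma powr_ge_tangent:
  fixes p c y :: real
  assumes "1 \<le> p" "0 \<le> c" "0 \<le> y"
  shows "c powr p + p * c powr (p - 1) * (y - c) \<le> y powr p"
proof (cases "c = 0 \<or> y = 0")
  case True
  then show ?thesis
  proof
    assume "c = 0" then show ?thesis by simp
  next
    assume y: "y = 0"
    have "c powr (p - 1) * c = c powr p"
      using assms by (cases "c = 0") (auto simp: powr_diff)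
    then show ?thesis
      using y assms mult_right_mono[of 1 p "c powr p"]
      by (simp add: algebra_simps)
  qed
next
  case False
  have "p * c powr (p - 1) * (y - c) \<le> y powr p - c powr p"
  proof (rule convex_on_imp_above_tangent[where A = "{0<..}" and f = "\<lambda>x. x powr p"])
    show "convex_on {0<..} (\<lambda>x::real. x powr p)"
      using convex_on_subset[OF powr_convex[OF assms(1)], of "{0<..}"] by auto
    show "((\<lambda>x. x powr p) has_real_derivative p * c powr (p - 1)) (at c within {0<..})"
      using False assms by (auto intro!: derivative_eq_intros)
  qed (use False assms in \<open>auto simp: interior_open\<close>)
  then show ?thesis by simp
qed

text \<open>Since \<open>p - 2\<close> is nonnegative and \<open>a\<close>, \<open>b\<close> are at
  most \<open>c\<close>, each of the two powers is at most the square times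
  \<open>c powr (p - 2)\<close>; the Pythagorean relation then sums the squares.\<close>

lemma powr_add_le_powr_sum_squares:
  fixes a b c p :: real
  assumes "2 \<le> p" "0 \<le> a" "0 \<le> b" "0 \<le> c" "a\<^sup>2 + b\<^sup>2 = c\<^sup>2"
  shows "a powr p + b powr p \<le> c powr p"
proof (cases "c = 0")
  case True
  then have "a = 0 \<and> b = 0"
    using assms(5) by (simp add: sum_power2_eq_zero_iff)
  then show ?thesis by simp
next
  case False
  have le: "x powr p \<le> x\<^sup>2 * c powr (p - 2)" if "0 \<le> x" "x \<le> c" for x
  proof (cases "x = 0")
    case False
    then have "x powr p = x powr 2 * x powr (p - 2)"
      using powr_add[of x 2 "p - 2"] by simp
    also have "\<dots> \<le> x powr 2 * c powr (p - 2)"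
      using that assms by (intro mult_left_mono powr_mono2) auto
    finally show ?thesis using that False by simp
  qed auto
  have "a\<^sup>2 \<le> c\<^sup>2" "b\<^sup>2 \<le> c\<^sup>2"
    unfolding assms(5)[symmetric] by simp_all
  then have ac: "a \<le> c" "b \<le> c"
    using \<open>0 \<le> c\<close> by (auto intro: power2_le_imp_le)
  have "a powr p + b powr p \<le> (a\<^sup>2 + b\<^sup>2) * c powr (p - 2)"
    using add_mono[OF le[OF \<open>0 \<le> a\<close> ac(1)] le[OF \<open>0 \<le> b\<close> ac(2)]]
    by (simp add: distrib_right)
  also have "\<dots> = c powr 2 * c powr (p - 2)"
    using assms(4,5) False by simp
  also have "\<dots> = c powr p"
    using powr_add[of c 2 "p - 2"] by simp
  finally show ?thesis .
qed

section \<open>Increments along paths and averaging over a family of maps\<close>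

text \<open>The increment is at most the integral of \<open>norm (h' t)\<close>, and Jensen's
  inequality moves the power inside. Differentiability is asked in the open interval so that the
  radial path, which starts at \<open>t = 0\<close>, is covered.\<close>

lemma norm_increment_powr_le:
  fixes h h' :: "real \<Rightarrow> 'a::euclidean_space"
  assumes "a < b" "1 \<le> p"
    and h: "continuous_on {a..b} h"
    and deriv: "\<And>t. t \<in> {a<..<b} \<Longrightarrow> (h has_vector_derivative h' t) (at t)"
    and h': "continuous_on {a..b} h'"
  shows "ennreal (norm (h b - h a) powr p)
    \<le> ennreal ((b - a) powr (p - 1)) * (\<integral>\<^sup>+t\<in>{a..b}. ennreal (norm (h' t) powr p) \<partial>lborel)"
proof -
  define I where "I = integral {a..b} (\<lambda>t. norm (h' t))"
  define c where "c = I / (b - a)"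
  define J where "J = integral {a..b} (\<lambda>t. norm (h' t) powr p)"
  have I: "((\<lambda>t. norm (h' t)) has_integral I) {a..b}"
    unfolding I_def using h'
    by (intro integrable_integral integrable_continuous_interval continuous_intros)
  have contp: "continuous_on {a..b} (\<lambda>t. norm (h' t) powr p)"
    using h' assms(2) by (intro continuous_on_powr' continuous_intros) auto
  have J: "((\<lambda>t. norm (h' t) powr p) has_integral J) {a..b}"
    unfolding J_def using contp
    by (intro integrable_integral integrable_continuous_interval)
  have I0: "0 \<le> I"
    unfolding I_def by (intro integral_nonneg) (use I in auto)
  then have c0: "0 \<le> c" using assms by (simp add: c_def)
  have FTC: "(h' has_integral (h b - h a)) {a..b}"
    using assms by (intro fundamental_theorem_of_calculus_interior) auto
  have "norm (integral {a..b} h') \<le> I"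
    unfolding I_def using FTC I by (intro integral_norm_bound_integral) auto
  then have "norm (h b - h a) \<le> I"
    using integral_unique[OF FTC] by simp
  then have "norm (h b - h a) powr p \<le> I powr p"
    using assms by (intro powr_mono2) auto
  also have I_eq: "I = (b - a) * c" using \<open>a < b\<close> by (simp add: c_def)
  also have "((b - a) * c) powr p = (b - a) powr (p - 1) * ((b - a) * c powr p)"
    using \<open>a < b\<close> c0 by (simp add: powr_mult powr_diff)
  also have "\<dots> \<le> (b - a) powr (p - 1) * J"
  proof (intro mult_left_mono)
    \<comment> \<open>Jensen by hand: the tangent inequality at the mean value \<open>c\<close> of
      \<open>norm (h' t)\<close> is integrated, and its linear term becomes a multiple of
      \<open>I - (b - a) * c\<close>, which is 0.\<close>
    have "((\<lambda>t. c powr p + p * c powr (p - 1) * (norm (h' t) - c)) has_integral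
        (b - a) * c powr p + p * c powr (p - 1) * (I - (b - a) * c)) {a..b}"
      using \<open>a < b\<close> has_integral_const_real[of "c powr p" a b] has_integral_const_real[of c a b]
      by (intro has_integral_add has_integral_mult_right has_integral_diff I) auto
    then have "(b - a) * c powr p + p * c powr (p - 1) * (I - (b - a) * c) \<le> J"
      by (rule has_integral_le[OF _ J]) (intro powr_ge_tangent[OF assms(2) c0] norm_ge_zero)
    then show "(b - a) * c powr p \<le> J"
      by (simp add: I_eq)
  qed auto
  finally have le: "norm (h b - h a) powr p \<le> (b - a) powr (p - 1) * J" .
  have "(\<integral>\<^sup>+t. ennreal (indicat_real {a..b} t *\<^sub>R norm (h' t) powr p) \<partial>lborel) = ennreal J"
  proof (rule nn_integral_has_integral_lborel)
    show "((\<lambda>t. indicat_real {a..b} t *\<^sub>R norm (h' t) powr p) has_integral J) UNIV"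
    proof -
      have "(\<lambda>t. indicat_real {a..b} t *\<^sub>R norm (h' t) powr p)
          = (\<lambda>t. if t \<in> {a..b} then norm (h' t) powr p else 0)"
        by (auto simp: fun_eq_iff)
      then show ?thesis
        using J has_integral_restrict_UNIV[of "{a..b}" "\<lambda>t. norm (h' t) powr p" J] by simp
    qed
    show "(\<lambda>t. indicat_real {a..b} t *\<^sub>R norm (h' t) powr p) \<in> borel_measurable borel"
      by (rule borel_measurable_continuous_on_indicator[OF _ contp]) auto
  qed auto
  also have "(\<integral>\<^sup>+t. ennreal (indicat_real {a..b} t *\<^sub>R norm (h' t) powr p) \<partial>lborel)
      = (\<integral>\<^sup>+t\<in>{a..b}. ennreal (norm (h' t) powr p) \<partial>lborel)"
    by (intro nn_integral_cong) (auto simp: indicator_def)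
  finally show ?thesis
    using ennreal_leI[OF le] by (simp add: ennreal_mult')
qed

text \<open>Tonelli's theorem puts the \<open>x\<close>-integral inside, where \<open>inv\<close>
  makes it independent of \<open>t\<close>; the \<open>t\<close>-integral then contributes the
  length \<open>b - a\<close>. The null endpoint \<open>a\<close> is left out of \<open>inv\<close>
  because the dilations used below collapse the plane at \<open>t = 0\<close>.\<close>

lemma nn_integral_le_by_averaging:
  fixes F V :: "'a::euclidean_space \<Rightarrow> ennreal" and \<phi> :: "real \<Rightarrow> 'a \<Rightarrow> 'a"
  assumes [measurable]: "F \<in> borel_measurable borel" "J \<in> borel_measurable borel"
      "case_prod \<phi> \<in> borel \<Otimes>\<^sub>M borel \<rightarrow>\<^sub>M borel"
    and "a \<le> b"
    and inv: "\<And>t. t \<in> {a<..b} \<Longrightarrow> (\<integral>\<^sup>+x. J t * F (\<phi> t x) \<partial>lborel) = (\<integral>\<^sup>+x. F x \<partial>lborel)"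
    and V: "\<And>x. V x \<le> C * (\<integral>\<^sup>+t\<in>{a..b}. J t * F (\<phi> t x) \<partial>lborel)"
  shows "(\<integral>\<^sup>+x. V x \<partial>lborel) \<le> C * (ennreal (b - a) * (\<integral>\<^sup>+x. F x \<partial>lborel))"
proof -
  have [measurable]: "(\<lambda>x. \<integral>\<^sup>+t\<in>{a..b}. J t * F (\<phi> t x) \<partial>lborel) \<in> borel_measurable borel"
    by measurable
  have "(\<integral>\<^sup>+x. V x \<partial>lborel) \<le> (\<integral>\<^sup>+x. C * (\<integral>\<^sup>+t\<in>{a..b}. J t * F (\<phi> t x) \<partial>lborel) \<partial>lborel)"
    by (intro nn_integral_mono V)
  also have "\<dots> = C * (\<integral>\<^sup>+x. (\<integral>\<^sup>+t\<in>{a..b}. J t * F (\<phi> t x) \<partial>lborel) \<partial>lborel)"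
    by (intro nn_integral_cmult) auto
  also have "(\<integral>\<^sup>+x. (\<integral>\<^sup>+t\<in>{a..b}. J t * F (\<phi> t x) \<partial>lborel) \<partial>lborel)
      = (\<integral>\<^sup>+t. (\<integral>\<^sup>+x. J t * F (\<phi> t x) * indicator {a..b} t \<partial>lborel) \<partial>lborel)"
    by (intro lborel_pair.Fubini') measurable
  also have "\<dots> = (\<integral>\<^sup>+t. (\<integral>\<^sup>+x. F x \<partial>lborel) * indicator {a..b} t \<partial>lborel)"
  proof (intro nn_integral_cong_AE)
    show "AE t in lborel. (\<integral>\<^sup>+x. J t * F (\<phi> t x) * indicator {a..b} t \<partial>lborel)
        = (\<integral>\<^sup>+x. F x \<partial>lborel) * indicator {a..b} t"
      using AE_lborel_singleton[of a]
    proof eventually_elim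
      case (elim t)
      then show ?case
        using inv[of t] by (cases "t \<in> {a..b}") auto
    qed
  qed
  also have "\<dots> = ennreal (b - a) * (\<integral>\<^sup>+x. F x \<partial>lborel)"
    using \<open>a \<le> b\<close> by (subst nn_integral_cmult_indicator) (auto simp: mult.commute)
  finally show ?thesis .
qed

section \<open>Lebesgue measure under dilations and orthogonal maps\<close>

lemma nn_integral_lborel_scaleR:
  fixes F :: "'a::euclidean_space \<Rightarrow> ennreal"
  assumes [measurable]: "F \<in> borel_measurable borel" and "c \<noteq> 0"
  shows "ennreal (\<bar>c\<bar> ^ DIM('a)) * (\<integral>\<^sup>+x. F (c *\<^sub>R x) \<partial>lborel) = (\<integral>\<^sup>+x. F x \<partial>lborel)"
  by (subst (2) lborel_affine[OF assms(2), of 0])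
     (simp add: nn_integral_density nn_integral_distr nn_integral_cmult)

text \<open>It suffices to test boxes. The preimage of a box is its image under
  \<open>inv f\<close>, which is again orthogonal and hence preserves its measure.\<close>

lemma lborel_distr_orthogonal_transformation:
  fixes f :: "real^'n::{finite,wellorder} \<Rightarrow> real^'n::_"
  assumes f: "orthogonal_transformation f"
  shows "distr lborel borel f = lborel"
proof (rule lborel_eqI[symmetric])
  have lin: "linear f" using f by (rule orthogonal_transformation_linear)
  then have [measurable]: "f \<in> borel_measurable borel"
    by (intro borel_measurable_continuous_onI linear_continuous_on)
       (simp add: linear_conv_bounded_linear)
  fix l u :: "(real, 'n) vec"
  assume le: "\<And>b. b \<in> Basis \<Longrightarrow> l \<bullet> b \<le> u \<bullet> b"
  have bij: "bij f" using f by (rule orthogonal_transformation_bij)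
  have vim: "f -` box l u = inv f ` box l u"
    using bij by (simp add: bij_vimage_eq_inv_image)
  have g: "orthogonal_transformation (inv f)"
    using f by (rule orthogonal_transformation_inv)
  have [measurable]: "f -` box l u \<in> sets borel"
    using measurable_sets[of f borel borel "box l u"] by simp
  have "emeasure (distr lborel borel f) (box l u) = emeasure lebesgue (inv f ` box l u)"
    by (simp add: emeasure_distr flip: vim)
  also have "\<dots> = ennreal (measure lebesgue (inv f ` box l u))"
    using measurable_orthogonal_image[OF g, of "box l u"] 
    by (intro emeasure_eq_measure2) auto
  also have "\<dots> = ennreal (measure lebesgue (box l u))"
    using measure_orthogonal_image[OF g, of "box l u"] by simp
  also have "\<dots> = (\<Prod>b\<in>Basis. (u - l) \<bullet> b)"
    using le by (simp add: measure_lborel_box_eq)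
  finally show "emeasure (distr lborel borel f) (box l u) = (\<Prod>b\<in>Basis. (u - l) \<bullet> b)" .
qed simp

section \<open>Rotations of the plane\<close>

definition rot :: "real \<Rightarrow> real^2 \<Rightarrow> real^2" where
  "rot t x = vector [cos t * x $ 1 - sin t * x $ 2, sin t * x $ 1 + cos t * x $ 2]"

lemma rot_nth [simp]:
  "rot t x $ 1 = cos t * x $ 1 - sin t * x $ 2"
  "rot t x $ 2 = sin t * x $ 1 + cos t * x $ 2"
  by (simp_all add: rot_def)

lemma norm_vec2_sq: "(norm x)\<^sup>2 = (norm (x $ 1))\<^sup>2 + (norm (x $ 2))\<^sup>2"
  for x :: "'a::real_normed_vector^2"
  by (simp add: norm_vec_def L2_set_def sum_2)

lemma norm_rot [simp]: "norm (rot t x) = norm x"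
proof -
  have "(norm (rot t x))\<^sup>2 = ((sin t)\<^sup>2 + (cos t)\<^sup>2) * (norm x)\<^sup>2"
    unfolding norm_vec2_sq by (simp add: power2_eq_square algebra_simps
        del: sin_cos_squared_add sin_cos_squared_add2 sin_cos_squared_add3)
  then show ?thesis by simp
qed

lemma orthogonal_transformation_rot: "orthogonal_transformation (rot t)"
  unfolding orthogonal_transformation
  by (auto intro!: linearI simp: vec_eq_iff forall_2 algebra_simps)

text \<open>The velocity is the quarter turn of \<open>x\<close> carried along by the rotation,
  hence the quarter turn of \<open>rot t x\<close>; this is the direction differentiated in
  \<open>angular_deriv\<close>.\<close>

lemma has_vector_derivative_rot:
  "((\<lambda>t. rot t x) has_vector_derivative rot t (vector [- x $ 2, x $ 1])) (at t)"
proof -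
  have eq: "(\<lambda>t. rot t x) = (\<lambda>t. cos t *\<^sub>R x + sin t *\<^sub>R vector [- x $ 2, x $ 1])"
    by (auto simp: vec_eq_iff forall_2 fun_eq_iff)
  show ?thesis unfolding eq
    by (auto intro!: derivative_eq_intros simp: vec_eq_iff forall_2)
qed

text \<open>Joint continuity supplies the measurability in the pair that Tonelli's theorem
  requires.\<close>

lemma continuous_on_rot: "continuous_on A (\<lambda>(t, x). rot t x)"
proof -
  have eq: "(\<lambda>(t, x). rot t x)
      = (\<lambda>z. \<chi> i. if i = 1 then cos (fst z) * snd z $ 1 - sin (fst z) * snd z $ 2
                      else sin (fst z) * snd z $ 1 + cos (fst z) * snd z $ 2)"
    by (auto simp: vec_eq_iff forall_2 fun_eq_iff)
  show ?thesis unfolding eq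
  proof (intro continuous_on_vec_lambda)
    show "continuous_on A (\<lambda>z. if i = 1 then cos (fst z) * snd z $ 1 - sin (fst z) * snd z $ 2
                      else sin (fst z) * snd z $ 1 + cos (fst z) * snd z $ 2)" for i :: 2
      by (cases "i = 1") (auto intro!: continuous_intros)
  qed
qed

section \<open>Distance to the integers\<close>

text \<open>The distance is attained at some integer \<open>n\<close> and is at most 1/2, so the
  sine on the left is nonnegative; shifting the angle by a multiple of \<open>pi\<close> changes at
  most the sign.\<close>

lemma sin_pi_infdist_Ints:
  fixes \<beta> :: real
  shows "sin (pi * infdist \<beta> \<int>) = \<bar>sin (pi * \<beta>)\<bar>"
proof -
  obtain x :: real where "x \<in> \<int>" "infdist \<beta> \<int> = dist \<beta> x"
    using infdist_attains_inf[of "\<int>" \<beta>] closed_Ints Ints_0 by blast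
  then obtain n :: int where n: "infdist \<beta> \<int> = \<bar>\<beta> - n\<bar>"
    by (metis Ints_cases dist_real_def)
  have "infdist \<beta> \<int> \<le> dist \<beta> (round \<beta>)"
    by (rule infdist_le) auto
  then have "infdist \<beta> \<int> \<le> 1/2"
    using of_int_round_abs_le[of \<beta>] by (simp add: dist_real_def abs_minus_commute)
  then have "0 \<le> sin (pi * infdist \<beta> \<int>)"
    by (intro sin_ge_zero) (auto simp: infdist_nonneg)
  then have "sin (pi * infdist \<beta> \<int>) = \<bar>sin (pi * \<bar>\<beta> - n\<bar>)\<bar>"
    by (simp add: n)
  also have "\<dots> = \<bar>sin (pi * (\<beta> - n))\<bar>"
    using sin_minus[of "pi * (\<beta> - n)"] by (simp add: abs_if algebra_simps)
  also have "\<dots> = \<bar>sin (pi * \<beta>)\<bar>"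
    by (simp add: right_diff_distrib sin_diff sin_npi_int cos_npi_int)
  finally show ?thesis .
qed

section \<open>Test functions supported away from the origin\<close>

lemma closed_supp: "closed (supp u)"
  by (simp add: supp_def)

lemma eq_0_outside_supp: "x \<notin> supp u \<Longrightarrow> u x = 0"
  using closure_subset[of "{x. u x \<noteq> 0}"] by (auto simp: supp_def)

lemma has_derivative_0_outside_supp:
  assumes "x \<notin> supp u"
  shows "(u has_derivative (\<lambda>_. 0)) (at x)"
proof (rule has_derivative_transform_within_open)
  show "open (- supp u)" using closed_supp by auto
  show "((\<lambda>_. 0) has_derivative (\<lambda>_. 0)) (at x)" by simp
qed (use assms in \<open>auto simp: eq_0_outside_supp\<close>)

lemma partial_deriv_0_outside_supp: "x \<notin> supp u \<Longrightarrow> partial_deriv i u x = 0"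
  unfolding partial_deriv_def
  using frechet_derivative_at[OF has_derivative_0_outside_supp] by metis

context
  fixes u :: "real^2 \<Rightarrow> complex"
  assumes u: "u \<in> Cc_inf (UNIV - {0})"
begin

lemma zero_notin_supp: "0 \<notin> supp u"
  using u by (auto simp: Cc_inf_def)

lemma compact_supp: "compact (supp u)"
  using u by (auto simp: Cc_inf_def)

text \<open>Away from 0 differentiability is part of smoothness; at 0 it holds because
  \<open>u\<close> vanishes on the open complement of its support. Linearity expands the derivative
  along the axes.\<close>

lemma test_fun_has_derivative:
  "(u has_derivative (\<lambda>h. h $ 1 *\<^sub>R partial_deriv 1 u x + h $ 2 *\<^sub>R partial_deriv 2 u x)) (at x)"
proof -
  have "u differentiable (at x)"
  proof (cases "x = 0")
    case True
    then show ?thesis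
      using has_derivative_0_outside_supp zero_notin_supp by (auto simp: differentiable_def)
  next
    case False
    have "Ck_on (Suc 0) (UNIV - {0}) u"
      using u by (simp add: Cc_inf_def Cinf_on_def del: Ck_on.simps)
    then have "u differentiable_on (UNIV - {0})" by simp
    then show ?thesis
      using False by (subst (asm) differentiable_on_eq_differentiable_at) auto
  qed
  then have D: "(u has_derivative frechet_derivative u (at x)) (at x)"
    by (simp add: frechet_derivative_works)
  interpret linear "frechet_derivative u (at x)"
    using D by (rule has_derivative_linear)
  have "frechet_derivative u (at x) h = h $ 1 *\<^sub>R partial_deriv 1 u x + h $ 2 *\<^sub>R partial_deriv 2 u x" for h
  proof -
    have "h = h $ 1 *\<^sub>R axis 1 1 + h $ 2 *\<^sub>R axis 2 1"
      by (auto simp: vec_eq_iff forall_2 axis_def)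
    then show ?thesis
      unfolding partial_deriv_def by (metis add scaleR)
  qed
  then have "frechet_derivative u (at x)
      = (\<lambda>h. h $ 1 *\<^sub>R partial_deriv 1 u x + h $ 2 *\<^sub>R partial_deriv 2 u x)"
    by (rule ext)
  then show ?thesis using D by simp
qed

lemma test_fun_chain:
  assumes "(\<gamma> has_vector_derivative v) (at t)"
  shows "((\<lambda>t. u (\<gamma> t)) has_vector_derivative
    (v $ 1 *\<^sub>R partial_deriv 1 u (\<gamma> t) + v $ 2 *\<^sub>R partial_deriv 2 u (\<gamma> t))) (at t)"
  using has_derivative_compose[OF assms[unfolded has_vector_derivative_def] test_fun_has_derivative]
  by (simp add: has_vector_derivative_def algebra_simps)

lemma continuous_on_test_fun: "continuous_on A u"
  using test_fun_has_derivative
  by (meson continuous_at_imp_continuous_on has_derivative_continuous)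

text \<open>The punctured plane and the complement of the support are open, cover the plane, and
  each carries continuity.\<close>

lemma continuous_on_partial_deriv: "continuous_on A (partial_deriv i u)"
proof -
  have "Ck_on (Suc 0) (UNIV - {0}) u"
    using u by (simp add: Cc_inf_def Cinf_on_def del: Ck_on.simps)
  then have "continuous_on (UNIV - {0}) (partial_deriv i u)" by simp
  moreover have "continuous_on (- supp u) (partial_deriv i u)"
    using partial_deriv_0_outside_supp
    by (subst continuous_on_cong[where g = "\<lambda>_. 0"]) auto
  ultimately have "continuous_on ((UNIV - {0}) \<union> (- supp u)) (partial_deriv i u)"
    using closed_supp by (intro continuous_on_open_Un) auto
  moreover have "(UNIV - {0}) \<union> (- supp u) = UNIV"
    using zero_notin_supp by auto
  ultimately show ?thesis
    by (metis continuous_on_subset subset_UNIV)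
qed

lemma continuous_on_test_fun_comp [continuous_intros]:
  assumes "continuous_on A f"
  shows "continuous_on A (\<lambda>x. u (f x))" "continuous_on A (\<lambda>x. partial_deriv i u (f x))"
  using continuous_on_compose[OF assms continuous_on_test_fun]
    continuous_on_compose[OF assms continuous_on_partial_deriv]
  by (simp_all add: o_def)

lemma borel_measurable_test_fun [measurable]:
  "u \<in> borel_measurable borel" "partial_deriv i u \<in> borel_measurable borel"
  by (intro borel_measurable_continuous_onI continuous_on_test_fun continuous_on_partial_deriv)+

text \<open>The compact support avoids the origin, so a singularity of \<open>f\<close> at 0 does no
  harm.\<close>

lemma integrable_supported_in_supp:
  fixes f :: "real^2 \<Rightarrow> real"
  assumes "continuous_on (UNIV - {0}) f" "\<And>x. x \<notin> supp u \<Longrightarrow> f x = 0"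
  shows "integrable lborel f"
proof -
  have "continuous_on (supp u) f"
    using assms(1) by (rule continuous_on_subset) (use zero_notin_supp in auto)
  then have "integrable lborel (\<lambda>x. indicator (supp u) x *\<^sub>R f x)"
    using compact_supp by (intro borel_integrable_compact)
  also have "(\<lambda>x. indicator (supp u) x *\<^sub>R f x) = f"
    using assms(2) by (auto simp: fun_eq_iff indicator_def)
  finally show ?thesis .
qed

section \<open>Radial and angular parts of the magnetic gradient\<close>

text \<open>This is \<open>norm x\<close> times the radial derivative. The potential does not enter
  because it is orthogonal to \<open>x\<close>.\<close>

definition euler_deriv :: "real^2 \<Rightarrow> complex" where
  "euler_deriv x = x $ 1 *\<^sub>R partial_deriv 1 u x + x $ 2 *\<^sub>R partial_deriv 2 u x"

text \<open>The magnetic derivative along the field \<open>(- x $ 2, x $ 1)\<close>, whose inner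
  product with the potential is the constant \<open>- \<beta>\<close> off the origin.\<close>

definition angular_deriv :: "real \<Rightarrow> real^2 \<Rightarrow> complex" where
  "angular_deriv \<beta> x = x $ 1 *\<^sub>R partial_deriv 2 u x - x $ 2 *\<^sub>R partial_deriv 1 u x - \<i> * \<beta> * u x"

lemma borel_measurable_euler_angular [measurable]:
  "euler_deriv \<in> borel_measurable borel" "angular_deriv \<beta> \<in> borel_measurable borel"
  unfolding euler_deriv_def[abs_def] angular_deriv_def[abs_def]
  by (auto intro!: borel_measurable_continuous_onI continuous_intros)

text \<open>With \<open>P\<close>, \<open>Q\<close> the components of the magnetic gradient and
  \<open>a\<close>, \<open>b\<close> those of \<open>x\<close>, the two derivatives are
  \<open>a P + b Q\<close> and \<open>a Q - b P\<close>: a rotation of \<open>(P, Q)\<close> scaled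
  by \<open>norm x\<close>.\<close>

lemma norm_magnetic_grad_sq:
  assumes "x \<noteq> 0"
  shows "(norm (euler_deriv x) / norm x)\<^sup>2 + (norm (angular_deriv \<beta> x) / norm x)\<^sup>2
    = (norm (magnetic_grad (AB_potential \<beta>) u x))\<^sup>2"
proof -
  define a b n where "a = x $ 1" and "b = x $ 2" and "n = (norm x)\<^sup>2"
  define P Q where "P = magnetic_grad (AB_potential \<beta>) u x $ 1"
    and "Q = magnetic_grad (AB_potential \<beta>) u x $ 2"
  have n_eq: "n = a\<^sup>2 + b\<^sup>2"
    using norm_vec2_sq[of x] by (simp add: a_def b_def n_def)
  have n_pos: "n > 0"
    using assms by (simp add: n_def)
  have P: "P = partial_deriv 1 u x + \<i> * of_real (\<beta> / n * b) * u x"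
    and Q: "Q = partial_deriv 2 u x - \<i> * of_real (\<beta> / n * a) * u x"
    by (simp_all add: P_def Q_def magnetic_grad_def AB_potential_def a_def b_def n_def)
  have e: "euler_deriv x = of_real a * P + of_real b * Q"
    by (simp add: euler_deriv_def P Q a_def b_def scaleR_conv_of_real algebra_simps)
  have "of_real a * (of_real (\<beta> / n * a) * u x) + of_real b * (of_real (\<beta> / n * b) * u x)
      = of_real (\<beta> / n * (a\<^sup>2 + b\<^sup>2)) * u x"
    by (simp add: algebra_simps power2_eq_square)
  also have "\<beta> / n * (a\<^sup>2 + b\<^sup>2) = \<beta>" using n_pos by (simp flip: n_eq)
  finally have "\<i> * of_real \<beta> * u x
      = \<i> * (of_real a * (of_real (\<beta> / n * a) * u x) + of_real b * (of_real (\<beta> / n * b) * u x))"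
    by simp
  then have t: "angular_deriv \<beta> x = of_real a * Q - of_real b * P"
    unfolding angular_deriv_def P Q
    by (simp only: flip: a_def b_def) (simp add: scaleR_conv_of_real algebra_simps)
  have "(norm (euler_deriv x))\<^sup>2 + (norm (angular_deriv \<beta> x))\<^sup>2
      = (a\<^sup>2 + b\<^sup>2) * ((norm P)\<^sup>2 + (norm Q)\<^sup>2)"
    unfolding e t cmod_power2 by (simp add: power2_eq_square algebra_simps)
  also have "\<dots> = n * (norm (magnetic_grad (AB_potential \<beta>) u x))\<^sup>2"
    by (simp add: norm_vec2_sq[of "magnetic_grad _ _ _"] P_def Q_def n_eq)
  finally show ?thesis
    using n_pos by (simp add: power_divide n_def[symmetric] flip: add_divide_distrib)
qed

lemma magnetic_grad_powr_ge:
  assumes "2 \<le> p"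
  shows "(norm (euler_deriv x) / norm x) powr p + (norm (angular_deriv \<beta> x) / norm x) powr p
    \<le> norm (magnetic_grad (AB_potential \<beta>) u x) powr p"
\<comment> \<open>At the origin division by zero gives 0, so the left side vanishes.\<close>
proof (cases "x = 0")
  case False
  show ?thesis
    by (intro powr_add_le_powr_sum_squares norm_magnetic_grad_sq assms False) auto
qed auto

section \<open>Radial and angular Hardy inequalities\<close>

text \<open>The exponent \<open>k = p / (p - 2)\<close> makes the Jacobian of \<open>x \<mapsto> t powr k *\<^sub>R x\<close> cancel the
  weight \<open>t powr ((k - 1) * p)\<close> that comes from differentiating \<open>t \<mapsto> u (t powr k *\<^sub>R x)\<close>; this is why
  the sharp Hardy constant comes out.\<close>
lemma radial_hardy:
  assumes "2 < p"
  shows "(\<integral>\<^sup>+x. ennreal ((norm (u x) / norm x) powr p) \<partial>lborel)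
    \<le> (\<integral>\<^sup>+x. ennreal ((p / (p - 2) * (norm (euler_deriv x) / norm x)) powr p) \<partial>lborel)"
proof -
  define k where "k = p / (p - 2)"
  \<comment> \<open>The factor 2 in \<open>2 * k\<close> is the dimension of the plane.\<close>
  have k: "1 < k" "(k - 1) * p = 2 * k"
    using assms by (auto simp: k_def field_simps)
  define F where "F x = ennreal ((k * (norm (euler_deriv x) / norm x)) powr p)" for x
  have "(\<integral>\<^sup>+x. ennreal ((norm (u x) / norm x) powr p) \<partial>lborel)
      \<le> 1 * (ennreal (1 - 0) * (\<integral>\<^sup>+x. F x \<partial>lborel))"
  proof (rule nn_integral_le_by_averaging[where J = "\<lambda>t. ennreal (t powr ((k - 1) * p))"
        and \<phi> = "\<lambda>t x. (t powr k) *\<^sub>R x"])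
    show F[measurable]: "F \<in> borel_measurable borel"
      unfolding F_def by measurable
    show "(\<integral>\<^sup>+x. ennreal (t powr ((k - 1) * p)) * F (t powr k *\<^sub>R x) \<partial>lborel) = (\<integral>\<^sup>+x. F x \<partial>lborel)"
      if "t \<in> {0<..1}" for t :: real
    proof -
      have "t powr ((k - 1) * p) = \<bar>t powr k\<bar> ^ DIM(real^2)"
        using that k by (simp add: power2_eq_square flip: powr_add)
      then show ?thesis
        using nn_integral_lborel_scaleR[OF F, of "t powr k"] that
        by (simp add: nn_integral_cmult)
    qed
    show "ennreal ((norm (u x) / norm x) powr p)
        \<le> 1 * (\<integral>\<^sup>+t\<in>{0..1}. ennreal (t powr ((k - 1) * p)) * F (t powr k *\<^sub>R x) \<partial>lborel)" for x
    proof -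
      define h where "h t = (1 / norm x) *\<^sub>R u ((t powr k) *\<^sub>R x)" for t :: real
      define h' where "h' t = (k * t powr (k - 1) / norm x) *\<^sub>R
          (x $ 1 *\<^sub>R partial_deriv 1 u ((t powr k) *\<^sub>R x) + x $ 2 *\<^sub>R partial_deriv 2 u ((t powr k) *\<^sub>R x))"
        for t :: real
      have "ennreal (norm (h 1 - h 0) powr p)
          \<le> ennreal ((1 - 0) powr (p - 1)) * (\<integral>\<^sup>+t\<in>{0..1}. ennreal (norm (h' t) powr p) \<partial>lborel)"
      proof (rule norm_increment_powr_le)
        show "(h has_vector_derivative h' t) (at t)" if "t \<in> {0<..<1}" for t
        proof -
          have "((\<lambda>t. (t powr k) *\<^sub>R x) has_vector_derivative (k * t powr (k - 1)) *\<^sub>R x) (at t)"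
            using that by (auto intro!: derivative_eq_intros)
          from has_vector_derivative_scaleR[OF DERIV_const[of "1 / norm x"] test_fun_chain[OF this]]
          show ?thesis
            unfolding h_def[abs_def] h'_def by (simp add: algebra_simps)
        qed
        show "continuous_on {0..1} h"
          unfolding h_def using k
          by (intro continuous_intros continuous_on_powr') auto
        \<comment> \<open>The exponent \<open>k - 1\<close> is positive, so continuity extends to
          \<open>t = 0\<close>.\<close>
        show "continuous_on {0..1} h'"
          unfolding h'_def divide_inverse using k
          by (intro continuous_intros continuous_on_powr') auto
      qed (use assms in auto)
      \<comment> \<open>\<open>h 0\<close> is a multiple of \<open>u 0\<close>, which
        vanishes.\<close>
      also have "norm (h 1 - h 0) = norm (u x) / norm x"
        using eq_0_outside_supp[OF zero_notin_supp] by (simp add: h_def)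
      also have "norm (h' t) powr p = t powr ((k - 1) * p) * (k * (norm (euler_deriv (t powr k *\<^sub>R x)) / norm (t powr k *\<^sub>R x))) powr p"
        if "t \<in> {0..1}" for t
      \<comment> \<open>For \<open>t \<noteq> 0\<close> the factor \<open>t powr k\<close> of
        \<open>euler_deriv\<close> at the dilated point cancels against the norm of that point; for
        \<open>t = 0\<close> both sides are 0.\<close>
      proof (cases "t = 0")
        case False
        have "norm (h' t) = t powr (k - 1) * (k * (norm (euler_deriv (t powr k *\<^sub>R x)) / norm (t powr k *\<^sub>R x)))"
        proof -
          have "euler_deriv (t powr k *\<^sub>R x) = (t powr k) *\<^sub>R
              (x $ 1 *\<^sub>R partial_deriv 1 u ((t powr k) *\<^sub>R x) + x $ 2 *\<^sub>R partial_deriv 2 u ((t powr k) *\<^sub>R x))"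
            by (simp add: euler_deriv_def algebra_simps)
          then show ?thesis
            using k False by (simp add: h'_def abs_mult)
        qed
        then show ?thesis
          using k by (simp only: powr_mult powr_powr)
      qed (use k in \<open>simp add: h'_def\<close>)
      then have "(\<integral>\<^sup>+t\<in>{0..1}. ennreal (norm (h' t) powr p) \<partial>lborel)
          = (\<integral>\<^sup>+t\<in>{0..1}. ennreal (t powr ((k - 1) * p)) * F (t powr k *\<^sub>R x) \<partial>lborel)"
        by (intro nn_integral_cong) (auto simp: F_def indicator_def ennreal_mult')
      finally show ?thesis by simp
    qed
  qed auto
  then show ?thesis by (simp add: F_def k_def)
qed

text \<open>Going once around a circle multiplies \<open>cis (- \<beta> t) * u (rot t x)\<close> by \<open>cis (- 2 * pi * \<beta>)\<close>,
  so the increment over a full turn already controls \<open>u x\<close>.\<close>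
lemma angular_hardy:
  assumes "1 \<le> p"
  shows "(\<integral>\<^sup>+x. ennreal ((2 * \<bar>sin (pi * \<beta>)\<bar> * (norm (u x) / norm x)) powr p) \<partial>lborel)
    \<le> (\<integral>\<^sup>+x. ennreal ((2 * pi * (norm (angular_deriv \<beta> x) / norm x)) powr p) \<partial>lborel)"
proof -
  define F where "F x = ennreal ((norm (angular_deriv \<beta> x) / norm x) powr p)" for x
  have F[measurable]: "F \<in> borel_measurable borel"
    unfolding F_def by measurable
  have "(\<integral>\<^sup>+x. ennreal ((2 * \<bar>sin (pi * \<beta>)\<bar> * (norm (u x) / norm x)) powr p) \<partial>lborel)
      \<le> ennreal ((2 * pi - 0) powr (p - 1)) * (ennreal (2 * pi - 0) * (\<integral>\<^sup>+x. F x \<partial>lborel))"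
  proof (rule nn_integral_le_by_averaging[where J = "\<lambda>t. 1" and \<phi> = rot])
    show "case_prod rot \<in> borel \<Otimes>\<^sub>M borel \<rightarrow>\<^sub>M borel"
      unfolding borel_prod by (intro borel_measurable_continuous_onI continuous_on_rot)
    show "(\<integral>\<^sup>+x. 1 * F (rot t x) \<partial>lborel) = (\<integral>\<^sup>+x. F x \<partial>lborel)" for t
    proof -
      have [measurable]: "rot t \<in> borel_measurable borel"
        using linear_continuous_on[of "rot t"] orthogonal_transformation_linear[OF orthogonal_transformation_rot]
        by (intro borel_measurable_continuous_onI) (simp add: linear_conv_bounded_linear)
      have "(\<integral>\<^sup>+x. F x \<partial>distr lborel borel (rot t)) = (\<integral>\<^sup>+x. F (rot t x) \<partial>lborel)"
        by (rule nn_integral_distr) auto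
      then show ?thesis
        by (simp add: lborel_distr_orthogonal_transformation[OF orthogonal_transformation_rot])
    qed
    show "ennreal ((2 * \<bar>sin (pi * \<beta>)\<bar> * (norm (u x) / norm x)) powr p)
        \<le> ennreal ((2 * pi - 0) powr (p - 1)) * (\<integral>\<^sup>+t\<in>{0..2 * pi}. 1 * F (rot t x) \<partial>lborel)" for x
    proof -
      define h where "h t = (1 / norm x) *\<^sub>R (cis (- \<beta> * t) * u (rot t x))" for t :: real
      \<comment> \<open>Differentiating the phase \<open>cis (- \<beta> * t)\<close> produces
        exactly the term with \<open>\<beta>\<close> in \<open>angular_deriv\<close>; being
        unimodular, the phase disappears from the norm.\<close>
      define h' where "h' t = (1 / norm x) *\<^sub>R (cis (- \<beta> * t) * angular_deriv \<beta> (rot t x))" for t :: real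
      have rot: "continuous_on A (\<lambda>t. rot t x)" for A
        using has_vector_derivative_rot
        by (meson continuous_at_imp_continuous_on has_vector_derivative_continuous)
      have "ennreal (norm (h (2 * pi) - h 0) powr p)
          \<le> ennreal ((2 * pi - 0) powr (p - 1)) * (\<integral>\<^sup>+t\<in>{0..2 * pi}. ennreal (norm (h' t) powr p) \<partial>lborel)"
      proof (rule norm_increment_powr_le)
        show "(h has_vector_derivative h' t) (at t)" for t
        proof -
          have "((\<lambda>t. cis (- \<beta> * t)) has_vector_derivative (- \<beta>) *\<^sub>R (\<i> * cis (- \<beta> * t))) (at t)"
            unfolding has_vector_derivative_def
            by (auto intro!: derivative_eq_intros simp: fun_eq_iff)
          from has_vector_derivative_scaleR[OF DERIV_const[of "1 / norm x"]
              has_vector_derivative_mult[OF this test_fun_chain[OF has_vector_derivative_rot]]]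
          show ?thesis
            unfolding h_def[abs_def] h'_def
            by (rule has_vector_derivative_eq_rhs)
               (simp add: angular_deriv_def scaleR_conv_of_real algebra_simps)
        qed
        show "continuous_on {0..2 * pi} h"
          unfolding h_def by (intro continuous_intros rot)
        show "continuous_on {0..2 * pi} h'"
          unfolding h'_def angular_deriv_def by (intro continuous_intros rot)
      qed (use assms in auto)
      also have "norm (h (2 * pi) - h 0) = 2 * \<bar>sin (pi * \<beta>)\<bar> * (norm (u x) / norm x)"
      proof -
        have "rot (2 * pi) x = x" "rot 0 x = x"
          by (auto simp: vec_eq_iff forall_2)
        then have "h (2 * pi) - h 0 = (1 / norm x) *\<^sub>R ((cis (- \<beta> * (2 * pi)) - 1) * u x)"
          by (simp add: h_def algebra_simps)
        \<comment> \<open>Extracting the half-turn phase leaves a difference of conjugates, so the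
          modulus is \<open>2 * \<bar>sin (pi * \<beta>)\<bar>\<close>.\<close>
        moreover have "cis (- \<beta> * (2 * pi)) - 1 = cis (- (pi * \<beta>)) * (cis (- (pi * \<beta>)) - cis (pi * \<beta>))"
          by (simp add: right_diff_distrib cis_mult algebra_simps)
        moreover have "cis (- (pi * \<beta>)) - cis (pi * \<beta>) = - 2 * \<i> * of_real (sin (pi * \<beta>))"
          by (simp add: complex_eq_iff)
        ultimately show ?thesis
          by (simp add: norm_mult)
      qed
      also have "(\<integral>\<^sup>+t\<in>{0..2 * pi}. ennreal (norm (h' t) powr p) \<partial>lborel)
          = (\<integral>\<^sup>+t\<in>{0..2 * pi}. 1 * F (rot t x) \<partial>lborel)"
        by (intro nn_integral_cong) (simp add: h'_def F_def norm_mult)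
      finally show ?thesis .
    qed
  qed auto
  also have "\<dots> = ennreal ((2 * pi) powr p) * (\<integral>\<^sup>+x. F x \<partial>lborel)"
    by (simp add: powr_diff flip: mult.assoc ennreal_mult')
  also have "\<dots> = (\<integral>\<^sup>+x. ennreal ((2 * pi) powr p) * F x \<partial>lborel)"
    by (simp add: nn_integral_cmult)
  also have "\<dots> = (\<integral>\<^sup>+x. ennreal ((2 * pi * (norm (angular_deriv \<beta> x) / norm x)) powr p) \<partial>lborel)"
    by (intro nn_integral_cong) (simp add: F_def powr_mult powr_divide flip: ennreal_mult')
  finally show ?thesis .
qed

end

section \<open>Combination of the two Hardy inequalities\<close>

theorem theorem1p4:
  fixes p \<beta> \<theta> :: real and u :: "real^2 \<Rightarrow> complex"
  assumes "2 \<le> p"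
    and "\<theta> = infdist \<beta> \<int>"
    and "u \<in> Cc_inf (UNIV - {0})"
  shows "(LINT x|lborel. norm (magnetic_grad (AB_potential \<beta>) u x) powr p)
    \<ge> (((p - 2) / p) powr p + (sin (pi * \<theta>) / pi) powr p)
        * (LINT x|lborel. norm (u x) powr p / norm x powr p)"
proof -
  note u = assms(3)
  define V where "V x = (norm (u x) / norm x) powr p" for x
  define G where "G x = norm (magnetic_grad (AB_potential \<beta>) u x) powr p" for x
  define R where "R x = (norm (euler_deriv u x) / norm x) powr p" for x
  define T where "T x = (norm (angular_deriv u \<beta> x) / norm x) powr p" for x
  note [measurable] = borel_measurable_test_fun[OF u] borel_measurable_euler_angular[OF u]
  have [measurable]: "V \<in> borel_measurable borel" "R \<in> borel_measurable borel"
      "T \<in> borel_measurable borel"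
    unfolding V_def R_def T_def by measurable
  \<comment> \<open>The Bochner integral of a non-integrable function is 0 by default, so
    integrability is secured before passing from nonnegative integrals to real ones.\<close>
  have intV: "integrable lborel V"
  proof (rule integrable_supported_in_supp[OF u])
    show "continuous_on (UNIV - {0}) V"
      unfolding V_def using assms(1)
      by (intro continuous_on_powr' continuous_intros continuous_on_test_fun[OF u]) auto
  qed (simp add: V_def eq_0_outside_supp)
  have intG: "integrable lborel G"
  proof (rule integrable_supported_in_supp[OF u])
    have "continuous_on (UNIV - {0}) (\<lambda>x :: real^2. \<beta> / (norm x)\<^sup>2 * x $ j)" for j
      by (auto intro!: continuous_intros)
    note this[of 1] this[of 2]
    then have AB: "continuous_on (UNIV - {0}) (\<lambda>x. AB_potential \<beta> x $ i)" for i
      using exhaust_2[of i] by (auto simp: AB_potential_def intro: continuous_on_minus)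
    have "continuous_on (UNIV - {0}) (magnetic_grad (AB_potential \<beta>) u)"
      unfolding magnetic_grad_def[abs_def]
      by (intro continuous_on_vec_lambda continuous_on_add continuous_on_mult continuous_on_of_real
          continuous_on_const AB continuous_on_test_fun[OF u] continuous_on_partial_deriv[OF u])
    then show "continuous_on (UNIV - {0}) G"
      unfolding G_def using assms(1) by (intro continuous_on_powr' continuous_intros) auto
    show "G x = 0" if "x \<notin> supp u" for x
    proof -
      have "magnetic_grad (AB_potential \<beta>) u x = 0"
        using that by (simp add: magnetic_grad_def eq_0_outside_supp partial_deriv_0_outside_supp vec_eq_iff)
      then show ?thesis by (simp add: G_def)
    qed
  qed
  have le: "R x + T x \<le> G x" for x
    unfolding R_def T_def G_def by (rule magnetic_grad_powr_ge[OF u assms(1)])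
  have nonneg: "0 \<le> R x" "0 \<le> T x" "0 \<le> V x" for x
    by (auto simp: R_def T_def V_def)
  have bounds: "norm (R x) \<le> norm (G x)" "norm (T x) \<le> norm (G x)" for x
    using le[of x] nonneg(1,2)[of x] by auto
  have intR: "integrable lborel R" and intT: "integrable lborel T"
    using bounds by (auto intro: Bochner_Integration.integrable_bound[OF intG])
  \<comment> \<open>Both Hardy inequalities pass through this transfer to real integrals:
    \<open>c = 1\<close>, \<open>d = p / (p - 2)\<close> for the radial one, and
    \<open>c = 2 * \<bar>sin (pi * \<beta>)\<bar>\<close>, \<open>d = 2 * pi\<close> for the angular
    one.\<close>
  have scaled_le: "c powr p * (\<integral>x. V x \<partial>lborel) \<le> d powr p * (\<integral>x. f x \<partial>lborel)"
    if "integrable lborel f" "\<And>x. f x = g x powr p" "0 \<le> c" "0 \<le> d" "\<And>x. 0 \<le> g x"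
      "(\<integral>\<^sup>+x. ennreal ((c * (norm (u x) / norm x)) powr p) \<partial>lborel)
        \<le> (\<integral>\<^sup>+x. ennreal ((d * g x) powr p) \<partial>lborel)"
    for c d :: real and f g :: "real^2 \<Rightarrow> real"
  proof -
    have f: "0 \<le> f x" for x
      using that(2) by simp
    have "(\<integral>\<^sup>+x. ennreal (c powr p * V x) \<partial>lborel) \<le> (\<integral>\<^sup>+x. ennreal (d powr p * f x) \<partial>lborel)"
      using that(2-6) by (simp add: V_def powr_mult powr_divide)
    moreover have "(\<integral>\<^sup>+x. ennreal (c powr p * V x) \<partial>lborel) = ennreal (\<integral>x. c powr p * V x \<partial>lborel)"
      using intV by (intro nn_integral_eq_integral) (auto simp: nonneg)
    moreover have "(\<integral>\<^sup>+x. ennreal (d powr p * f x) \<partial>lborel) = ennreal (\<integral>x. d powr p * f x \<partial>lborel)"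
      using that(1) f by (intro nn_integral_eq_integral) auto
    moreover have "0 \<le> (\<integral>x. d powr p * f x \<partial>lborel)"
      using f by (intro integral_nonneg_AE) auto
    ultimately show ?thesis by simp
  qed
  have radial: "((p - 2) / p) powr p * (\<integral>x. V x \<partial>lborel) \<le> (\<integral>x. R x \<partial>lborel)"
  \<comment> \<open>At \<open>p = 2\<close> the radial constant is 0 and nonnegativity of
    \<open>R\<close> suffices.\<close>
  proof (cases "p = 2")
    case False
    then have "2 < p" using assms by simp
    have "1 powr p * (\<integral>x. V x \<partial>lborel) \<le> (p / (p - 2)) powr p * (\<integral>x. R x \<partial>lborel)"
      by (rule scaled_le[OF intR R_def]) (use \<open>2 < p\<close> radial_hardy[OF u \<open>2 < p\<close>] in auto)
    then show ?thesis
      using \<open>2 < p\<close> by (simp add: powr_divide field_simps)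
  qed (use nonneg in simp)
  have angular: "(sin (pi * \<theta>) / pi) powr p * (\<integral>x. V x \<partial>lborel) \<le> (\<integral>x. T x \<partial>lborel)"
  proof -
    have "(2 * \<bar>sin (pi * \<beta>)\<bar>) powr p * (\<integral>x. V x \<partial>lborel) \<le> (2 * pi) powr p * (\<integral>x. T x \<partial>lborel)"
      by (rule scaled_le[OF intT T_def]) (use angular_hardy[OF u, of p \<beta>] assms in auto)
    then show ?thesis
      unfolding assms(2) sin_pi_infdist_Ints
      by (simp add: powr_divide powr_mult field_simps)
  qed
  have "(((p - 2) / p) powr p + (sin (pi * \<theta>) / pi) powr p) * (\<integral>x. V x \<partial>lborel)
      \<le> (\<integral>x. R x \<partial>lborel) + (\<integral>x. T x \<partial>lborel)"
    using radial angular by (simp add: distrib_right)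
  also have "\<dots> = (\<integral>x. R x + T x \<partial>lborel)"
    using intR intT by simp
  also have "\<dots> \<le> (\<integral>x. G x \<partial>lborel)"
    using intR intT intG le by (intro integral_mono) auto
  finally show ?thesis
    by (simp add: V_def G_def powr_divide)
qed

end
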